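(* Let $\mathcal{F}$ be a finite family of convex sets in $\mathbb{R}^d$. If the intersection of every $2d^2$ or fewer elements of $\mathcal{F}$ has diameter greater than or equal to $1$, then $\bigcap \mathcal{F}$ has diameter greater than or equal to $d^{-1/2}$.
   Context: Diameter is measured in the Euclidean norm: the diameter of a set is the supremum of the distances between pairs of its points. *)

theory Defs
  imports "HOL-Analysis.Analysis"
begin

text \<open>
  The library's \<^term>\<open>diameter\<close> is real-valued, hence unspecified on unbounded sets. The convex
  sets considered here may be unbounded, so the diameter takes values in \<^typ>\<open>ennreal\<close>: it is
  \<^term>\<open>\<infinity> :: ennreal\<close> on unbounded sets, and \<open>0\<close> on the empty set.
\<close>

definition ediameter :: "'a::metric_space set \<Rightarrow> ennreal" where
  "ediameter S = (SUP (x, y) \<in> S \<times> S. ennreal (dist x y))"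

end

theory Submission imports Defs begin

text \<open>
  Measure a set by its widths along the coordinate axes. If \<open>\<Inter>\<F>\<close> had diameter less than
  \<open>1 / sqrt d\<close>, then each of its \<open>d\<close> coordinate widths would be less than \<open>1 / sqrt d\<close>. Smallness of one
  width is witnessed by at most \<open>2d\<close> members of \<open>\<F>\<close> (\<open>helly_width\<close>): by Helly's theorem, a strict
  upper bound for a linear functional on a nonempty \<open>\<Inter>\<F>\<close> already holds on the intersection of
  \<open>d\<close> members, because the complementary half-space takes one of the \<open>d + 1\<close> places in a subfamily
  with empty intersection; the lower bound costs \<open>d\<close> further members. Pooling the witnesses of all
  axes gives at most \<open>2d\<^sup>2\<close> members whose intersection has all coordinate widths less than
  \<open>1 / sqrt d\<close>, hence diameter less than \<open>1\<close> by Pythagoras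
  (\<open>ediameter_less_of_coordinate_widths\<close>), which is a contradiction.
\<close>

lemma dist_le_ediameter:
  assumes "x \<in> S" "y \<in> S"
  shows "ennreal (dist x y) \<le> ediameter S"
  unfolding ediameter_def using assms by (intro SUP_upper2[of "(x, y)"]) auto

lemma ediameter_le:
  assumes "\<And>x y. x \<in> S \<Longrightarrow> y \<in> S \<Longrightarrow> ennreal (dist x y) \<le> c"
  shows "ediameter S \<le> c"
  unfolding ediameter_def using assms by (intro SUP_least) auto

lemma ediameter_mono: "S \<subseteq> T \<Longrightarrow> ediameter S \<le> ediameter T"
  by (intro ediameter_le dist_le_ediameter) auto

lemma ediameter_inner_image_le:
  fixes u :: "'a::euclidean_space"
  assumes "norm u \<le> 1"
  shows "ediameter ((\<bullet>) u ` S) \<le> ediameter S"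
proof (rule ediameter_le)
  fix a b assume "a \<in> (\<bullet>) u ` S" "b \<in> (\<bullet>) u ` S"
  then obtain x y where xy: "x \<in> S" "y \<in> S" "a = u \<bullet> x" "b = u \<bullet> y"
    by blast
  have "dist a b = \<bar>u \<bullet> (x - y)\<bar>"
    by (simp add: xy dist_real_def inner_diff_right)
  also have "\<dots> \<le> norm u * norm (x - y)"
    by (rule Cauchy_Schwarz_ineq2)
  also have "\<dots> \<le> dist x y"
    using assms by (simp add: dist_norm mult_left_le_one_le)
  finally have "ennreal (dist a b) \<le> ennreal (dist x y)"
    by (rule ennreal_leI)
  also have "\<dots> \<le> ediameter S"
    by (rule dist_le_ediameter) (use xy in auto)
  finally show "ennreal (dist a b) \<le> ediameter S" .
qed

lemma ediameter_real_less_imp_interval: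
  fixes S :: "real set"
  assumes "S \<noteq> {}" "ediameter S < ennreal c"
  obtains s t where "S \<subseteq> {s<..<t}" "t - s < c"
proof -
  obtain w where w: "ediameter S = ennreal w" "0 \<le> w" "w < c"
    using assms(2) by (cases "ediameter S") (auto simp: ennreal_less_iff)
  have close: "\<bar>x - y\<bar> \<le> w" if "x \<in> S" "y \<in> S" for x y
    using dist_le_ediameter[OF that] w by (simp add: dist_real_def)
  obtain z where z: "z \<in> S"
    using assms(1) by blast
  have bdd: "bdd_above S" "bdd_below S"
    using close[OF _ z] by (fastforce intro: bdd_aboveI[of _ "z + w"] bdd_belowI[of _ "z - w"] simp: abs_le_iff)+
  have "x \<le> y + w" if "x \<in> S" "y \<in> S" for x y
    using close[OF that] by linarith
  then have "Sup S \<le> y + w" if "y \<in> S" for y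
    using that z by (intro cSup_least) auto
  then have "Sup S - w \<le> Inf S"
    using z by (intro cInf_greatest) (auto simp: algebra_simps)
  moreover define e where "e = (c - w) / 3"
  moreover have "e > 0"
    using w by (simp add: e_def)
  moreover have "S \<subseteq> {Inf S - e<..<Sup S + e}"
    using \<open>e > 0\<close> bdd by (force dest: cInf_lower cSup_upper)
  moreover have "Sup S + e - (Inf S - e) < c"
    using \<open>Sup S - w \<le> Inf S\<close> w by (simp add: e_def field_simps)
  ultimately show thesis
    using that by blast
qed

lemma ediameter_less_of_subset_interval:
  fixes S :: "real set"
  assumes "S \<subseteq> {s<..<t}" "t - s < c" "0 < c"
  shows "ediameter S < ennreal c"
proof -
  have "ediameter S \<le> ennreal (t - s)"
  proof (intro ediameter_le ennreal_leI)
    fix x y assume "x \<in> S" "y \<in> S"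
    then have "s < x" "x < t" "s < y" "y < t"
      using assms(1) by auto
    then show "dist x y \<le> t - s"
      by (simp add: dist_real_def)
  qed
  also have "\<dots> < ennreal c"
    using assms(2,3) by (cases "0 \<le> t - s") (auto simp: ennreal_less_iff ennreal_neg)
  finally show ?thesis .
qed

text \<open>The contrapositive of Helly's theorem, phrased so that small families need no separate
  treatment.\<close>

lemma helly_empty_subfamily:
  fixes \<F> :: "'a::euclidean_space set set"
  assumes "finite \<F>" "\<And>K. K \<in> \<F> \<Longrightarrow> convex K" "\<Inter>\<F> = {}"
  obtains \<G> where "\<G> \<subseteq> \<F>" "card \<G> \<le> DIM('a) + 1" "\<Inter>\<G> = {}"
proof (cases "card \<F> \<le> DIM('a) + 1")
  case True
  then show thesis
    using that assms(3) by blast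
next
  case False
  then have "\<not> (\<forall>\<G>. \<G> \<subseteq> \<F> \<longrightarrow> card \<G> = DIM('a) + 1 \<longrightarrow> \<Inter>\<G> \<noteq> {})"
    using Helly[of \<F>] assms(2,3) by (meson linorder_le_cases)
  then show thesis
    using that by (metis order_refl)
qed

text \<open>The half-space where the bound fails has empty intersection with \<open>\<Inter>\<F>\<close>. A subfamily of
  \<open>d + 1\<close> sets with empty intersection must contain this half-space, since \<open>\<Inter>\<F>\<close> is nonempty; so
  only \<open>d\<close> members of \<open>\<F>\<close> remain.\<close>

lemma helly_strict_bound:
  fixes \<F> :: "'a::euclidean_space set set"
  assumes "finite \<F>" "\<And>K. K \<in> \<F> \<Longrightarrow> convex K" "\<Inter>\<F> \<noteq> {}"
    and bound: "\<And>x. x \<in> \<Inter>\<F> \<Longrightarrow> u \<bullet> x < t"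
  obtains \<G> where "\<G> \<subseteq> \<F>" "card \<G> \<le> DIM('a)" "\<And>x. x \<in> \<Inter>\<G> \<Longrightarrow> u \<bullet> x < t"
proof -
  define H where "H = {x. u \<bullet> x \<ge> t}"
  have "convex H"
    by (simp add: H_def convex_halfspace_ge)
  moreover have "\<Inter>(insert H \<F>) = {}"
    using bound by (force simp: H_def)
  ultimately obtain \<K> where \<K>: "\<K> \<subseteq> insert H \<F>" "card \<K> \<le> DIM('a) + 1" "\<Inter>\<K> = {}"
    using helly_empty_subfamily[of "insert H \<F>"] assms(1,2) by (metis finite_insert insert_iff)
  have "H \<in> \<K>"
    using \<K>(1,3) assms(3) by blast
  show thesis
  proof (rule that[of "\<K> - {H}"])
    show "\<K> - {H} \<subseteq> \<F>"
      using \<K>(1) by blast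
    show "card (\<K> - {H}) \<le> DIM('a)"
      using \<K>(2) \<open>H \<in> \<K>\<close> by (simp add: card_Diff_singleton)
    show "u \<bullet> x < t" if "x \<in> \<Inter>(\<K> - {H})" for x
    proof (rule ccontr)
      assume "\<not> u \<bullet> x < t"
      then have "x \<in> \<Inter>\<K>"
        using that by (auto simp: H_def)
      then show False
        using \<K>(3) by simp
    qed
  qed
qed

text \<open>Here \<open>ediameter ((\<bullet>) u ` S)\<close> is the width of \<open>S\<close> in the direction of a unit vector \<open>u\<close>. The
  count \<open>2d\<close> comes from bounding the functional on each side with \<open>d\<close> members; when \<open>\<Inter>\<F>\<close> is
  empty, Helly's theorem gives \<open>d + 1 \<le> 2d\<close> members with empty intersection.\<close>

lemma helly_width:
  fixes \<F> :: "'a::euclidean_space set set"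
  assumes "finite \<F>" "\<And>K. K \<in> \<F> \<Longrightarrow> convex K"
    and small: "ediameter ((\<bullet>) u ` \<Inter>\<F>) < ennreal c"
  obtains \<G> where "\<G> \<subseteq> \<F>" "card \<G> \<le> 2 * DIM('a)" "ediameter ((\<bullet>) u ` \<Inter>\<G>) < ennreal c"
proof (cases "\<Inter>\<F> = {}")
  case True
  obtain \<G> where \<G>: "\<G> \<subseteq> \<F>" "card \<G> \<le> DIM('a) + 1" "\<Inter>\<G> = {}"
    using helly_empty_subfamily[OF assms(1,2) True] by blast
  have "card \<G> \<le> 2 * DIM('a)"
    using \<G>(2) DIM_positive[where 'a='a] by linarith
  then show thesis
    using that \<G> small True by simp
next
  case False
  have "0 < c"
    using small by (cases "0 < c") (auto simp: ennreal_neg)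
  obtain s t where st: "(\<bullet>) u ` \<Inter>\<F> \<subseteq> {s<..<t}" "t - s < c"
    using ediameter_real_less_imp_interval[OF _ small] False by blast
  have upper: "u \<bullet> x < t" and lower: "(- u) \<bullet> x < - s" if "x \<in> \<Inter>\<F>" for x
    using st(1) that by (force simp: image_subset_iff)+
  obtain \<G> where \<G>: "\<G> \<subseteq> \<F>" "card \<G> \<le> DIM('a)" "\<And>x. x \<in> \<Inter>\<G> \<Longrightarrow> u \<bullet> x < t"
    using helly_strict_bound[OF assms(1,2) False upper] by blast
  obtain \<H> where \<H>: "\<H> \<subseteq> \<F>" "card \<H> \<le> DIM('a)" "\<And>x. x \<in> \<Inter>\<H> \<Longrightarrow> (- u) \<bullet> x < - s"
    using helly_strict_bound[OF assms(1,2) False lower] by blast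
  show thesis
  proof (rule that[of "\<G> \<union> \<H>"])
    show "\<G> \<union> \<H> \<subseteq> \<F>"
      using \<G>(1) \<H>(1) by blast
    show "card (\<G> \<union> \<H>) \<le> 2 * DIM('a)"
      using card_Un_le[of \<G> \<H>] \<G>(2) \<H>(2) by linarith
    have "(\<bullet>) u ` \<Inter>(\<G> \<union> \<H>) \<subseteq> {s<..<t}"
      using \<G>(3) \<H>(3) by auto
    then show "ediameter ((\<bullet>) u ` \<Inter>(\<G> \<union> \<H>)) < ennreal c"
      by (rule ediameter_less_of_subset_interval) (use st(2) \<open>0 < c\<close> in auto)
  qed
qed

text \<open>Pythagoras on the differences of coordinates. The inequality stays strict under the supremum
  over all pairs because the largest of the finitely many widths is itself less than \<open>c\<close>.\<close>

lemma ediameter_less_of_coordinate_widths: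
  fixes S :: "'a::euclidean_space set"
  assumes "\<And>b. b \<in> Basis \<Longrightarrow> ediameter ((\<bullet>) b ` S) < ennreal c"
  shows "ediameter S < ennreal (sqrt DIM('a) * c)"
proof -
  define m where "m = Max ((\<lambda>b. ediameter ((\<bullet>) b ` S)) ` (Basis :: 'a set))"
  have "m < ennreal c"
    unfolding m_def using assms by (subst Max_less_iff) auto
  then obtain w where w: "m = ennreal w" "0 \<le> w" "w < c"
    by (cases m) (auto simp: ennreal_less_iff)
  have "dist x y \<le> sqrt DIM('a) * w" if "x \<in> S" "y \<in> S" for x y
  proof -
    have "dist (b \<bullet> x) (b \<bullet> y) \<le> w" if "b \<in> Basis" for b
    proof -
      have "ennreal (dist (b \<bullet> x) (b \<bullet> y)) \<le> ediameter ((\<bullet>) b ` S)"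
        using \<open>x \<in> S\<close> \<open>y \<in> S\<close> by (intro dist_le_ediameter) auto
      also have "\<dots> \<le> ennreal w"
        unfolding w(1)[symmetric] m_def using that by (intro Max_ge) auto
      finally show ?thesis
        using w(2) by simp
    qed
    then have "(dist (x \<bullet> b) (y \<bullet> b))\<^sup>2 \<le> w\<^sup>2" if "b \<in> Basis" for b
      by (intro power_mono zero_le_dist) (metis inner_commute that)
    then have "(\<Sum>b\<in>Basis. (dist (x \<bullet> b) (y \<bullet> b))\<^sup>2) \<le> DIM('a) * w\<^sup>2"
      using sum_bounded_above[of Basis "\<lambda>b. (dist (x \<bullet> b) (y \<bullet> b))\<^sup>2" "w\<^sup>2"] by simp
    then have "dist x y \<le> sqrt (DIM('a) * w\<^sup>2)"
      by (simp add: euclidean_dist_l2[of x y] L2_set_def)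
    then show ?thesis
      using w(2) by (simp add: real_sqrt_mult)
  qed
  then have "ediameter S \<le> ennreal (sqrt DIM('a) * w)"
    by (intro ediameter_le ennreal_leI)
  also have "\<dots> < ennreal (sqrt DIM('a) * c)"
    using w DIM_positive[where 'a='a] by (subst ennreal_less_iff) auto
  finally show ?thesis .
qed

text \<open>The factor \<open>sqrt d\<close> is the price of replacing the diameter by the largest coordinate width,
  and the second factor \<open>d\<close> in the count comes from treating the \<open>d\<close> axes separately.\<close>

lemma helly_diameter:
  fixes \<F> :: "'a::euclidean_space set set"
  assumes "finite \<F>" "\<And>K. K \<in> \<F> \<Longrightarrow> convex K"
    and small: "ediameter (\<Inter>\<F>) < ennreal c"
  obtains \<G> where "\<G> \<subseteq> \<F>" "card \<G> \<le> 2 * DIM('a)\<^sup>2"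
    "ediameter (\<Inter>\<G>) < ennreal (sqrt DIM('a) * c)"
proof -
  have "\<exists>\<G>\<subseteq>\<F>. card \<G> \<le> 2 * DIM('a) \<and> ediameter ((\<bullet>) b ` \<Inter>\<G>) < ennreal c"
    if "b \<in> Basis" for b :: 'a
  proof -
    have "ediameter ((\<bullet>) b ` \<Inter>\<F>) < ennreal c"
      using ediameter_inner_image_le[of b "\<Inter>\<F>"] that small by simp
    then show ?thesis
      using helly_width[OF assms(1,2)] by metis
  qed
  then obtain \<G> where \<G>: "\<And>b. b \<in> Basis \<Longrightarrow> \<G> b \<subseteq> \<F>"
      "\<And>b. b \<in> Basis \<Longrightarrow> card (\<G> b) \<le> 2 * DIM('a)"
      "\<And>b :: 'a. b \<in> Basis \<Longrightarrow> ediameter ((\<bullet>) b ` \<Inter>(\<G> b)) < ennreal c"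
    by metis
  define \<U> where "\<U> = (\<Union>b\<in>Basis. \<G> b)"
  show thesis
  proof (rule that[of \<U>])
    show "\<U> \<subseteq> \<F>"
      using \<G>(1) by (auto simp: \<U>_def)
    have "card \<U> \<le> (\<Sum>b\<in>Basis. card (\<G> b))"
      unfolding \<U>_def by (rule card_UN_le) simp
    also have "\<dots> \<le> DIM('a) * (2 * DIM('a))"
      using sum_bounded_above[of Basis "\<lambda>b. card (\<G> b)" "2 * DIM('a)"] \<G>(2) by simp
    finally show "card \<U> \<le> 2 * DIM('a)\<^sup>2"
      by (simp add: power2_eq_square)
    show "ediameter (\<Inter>\<U>) < ennreal (sqrt DIM('a) * c)"
    proof (rule ediameter_less_of_coordinate_widths)
      fix b :: 'a assume b: "b \<in> Basis"
      have "ediameter ((\<bullet>) b ` \<Inter>\<U>) \<le> ediameter ((\<bullet>) b ` \<Inter>(\<G> b))"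
        using b by (intro ediameter_mono image_mono) (auto simp: \<U>_def)
      then show "ediameter ((\<bullet>) b ` \<Inter>\<U>) < ennreal c"
        using \<G>(3)[OF b] by (rule le_less_trans)
    qed
  qed
qed

theorem corollary1p6:
  fixes \<F> :: "(real ^ 'd) set set"
  assumes "finite \<F>"
    and "\<And>K. K \<in> \<F> \<Longrightarrow> convex K"
    and "\<And>\<G>. \<G> \<subseteq> \<F> \<Longrightarrow> card \<G> \<le> 2 * CARD('d) ^ 2 \<Longrightarrow> ediameter (\<Inter>\<G>) \<ge> 1"
  shows "ediameter (\<Inter>\<F>) \<ge> ennreal (real CARD('d) powr (- 1 / 2))"
proof (rule ccontr)
  assume "\<not> ?thesis"
  then have "ediameter (\<Inter>\<F>) < ennreal (real CARD('d) powr (- 1 / 2))"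
    by simp
  from helly_diameter[OF assms(1,2) this]
  obtain \<G> where \<G>: "\<G> \<subseteq> \<F>" "card \<G> \<le> 2 * CARD('d)\<^sup>2"
    "ediameter (\<Inter>\<G>) < ennreal (sqrt CARD('d) * real CARD('d) powr (- 1 / 2))"
    by auto
  have "sqrt CARD('d) * real CARD('d) powr (- 1 / 2) = 1"
    by (simp add: powr_half_sqrt[symmetric] powr_add[symmetric])
  then show False
    using \<G> assms(3)[OF \<G>(1,2)] by simp
qed

end
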